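(* Suppose that $c:\mathbb{X}\times\mathbb{U}\to\mathbb{R}$ is non-negative, bounded, and continuous on $\mathbb{X}\times\mathbb{U}$, and that $\mathbb{U}$ is convex. If $\{Q_n\}$ is a sequence of channels in $\mathcal{Q}$ converging weakly at input $P$ to a channel $Q\in\mathcal{Q}$, then $$\limsup_{n\to\infty} J(P,Q_n)\le J(P,Q),$$ that is, $J(P,\cdot)$ is upper semi-continuous on $\mathcal{Q}$ under weak convergence.
   Context: $\mathbb{X}\subset\mathbb{R}^n$, $\mathbb{Y}\subset\mathbb{R}^m$ and $\mathbb{U}\subset\mathbb{R}^k$ are Borel sets ($\mathbb{U}$ nonempty). A channel $Q$ is a stochastic kernel from $\mathbb{X}$ to $\mathbb{Y}$: $Q(\cdot|x)$ is a Borel probability measure on $\mathbb{Y}$ for every $x\in\mathbb{X}$, and $x\mapsto Q(A|x)$ is Borel measurable for every Borel $A\subset\mathbb{Y}$. $\mathcal{Q}$ is the set of all channels from $\mathbb{X}$ to $\mathbb{Y}$. $P$ is a fixed Borel probability measure on $\mathbb{X}$, and $PQ$ is the joint probability measure on $\mathbb{X}\times\mathbb{Y}$ given by $PQ(A)=\int_A Q(dy|x)P(dx)$. The single-stage optimal cost is $$J(P,Q)=\inf_{\gamma\in\mathcal{G}}\int_{\mathbb{X}\times\mathbb{Y}} c(x,\gamma(y))\,Q(dy|x)P(dx),$$ where $\mathcal{G}$ is the set of all Borel measurable functions $\gamma:\mathbb{Y}\to\mathbb{U}$. $Q_n\to Q$ weakly at input $P$ means that $PQ_n\to PQ$ weakly,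 i.e. $\int f\,d(PQ_n)\to\int f\,d(PQ)$ for every bounded continuous real function $f$ on $\mathbb{X}\times\mathbb{Y}$. *)

theory Defs
  imports "HOL-Probability.Probability"
begin

abbreviation borel_on :: "'a::topological_space set \<Rightarrow> 'a measure" where
  "borel_on S \<equiv> restrict_space borel S"

(* prob_algebra carries the coarsest sigma-algebra that makes every evaluation
   M \<mapsto> M(A) measurable, so these are exactly the stochastic kernels from X to Y;
   only the values Q x with x in X matter. See channels_iff. *)
definition channels ::
    "'a::topological_space set \<Rightarrow> 'b::topological_space set \<Rightarrow> ('a \<Rightarrow> 'b measure) set" where
  "channels X Y = borel_on X \<rightarrow>\<^sub>M prob_algebra (borel_on Y)"

lemma channels_iff:
  fixes X :: "'a::topological_space set" and Y :: "'b::topological_space set"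
  shows "Q \<in> channels X Y \<longleftrightarrow>
    (\<forall>x\<in>X. prob_space (Q x) \<and> sets (Q x) = sets (borel_on Y)) \<and>
    (\<forall>A\<in>sets (borel_on Y). (\<lambda>x. measure (Q x) A) \<in> borel_measurable (borel_on X))"
proof
  assume Q: "Q \<in> channels X Y"
  then have "Q \<in> borel_on X \<rightarrow>\<^sub>M subprob_algebra (borel_on Y)"
    unfolding channels_def by (rule measurable_prob_algebraD)
  from measurable_compose[OF this measurable_measure_subprob_algebra]
  show "(\<forall>x\<in>X. prob_space (Q x) \<and> sets (Q x) = sets (borel_on Y)) \<and>
    (\<forall>A\<in>sets (borel_on Y). (\<lambda>x. measure (Q x) A) \<in> borel_measurable (borel_on X))"
    using measurable_space[OF Q[unfolded channels_def]]
    by (auto simp: space_prob_algebra space_restrict_space)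
next
  assume *: "(\<forall>x\<in>X. prob_space (Q x) \<and> sets (Q x) = sets (borel_on Y)) \<and>
    (\<forall>A\<in>sets (borel_on Y). (\<lambda>x. measure (Q x) A) \<in> borel_measurable (borel_on X))"
  show "Q \<in> channels X Y"
    unfolding channels_def
  proof (rule measurable_prob_algebraI)
    show "prob_space (Q x)" if "x \<in> space (borel_on X)" for x
      using * that by (auto simp: space_restrict_space)
    show "Q \<in> borel_on X \<rightarrow>\<^sub>M subprob_algebra (borel_on Y)"
    proof (rule measurable_subprob_algebra)
      fix x assume "x \<in> space (borel_on X)"
      with * show "subprob_space (Q x)" "sets (Q x) = sets (borel_on Y)"
        by (auto simp: space_restrict_space intro: prob_space_imp_subprob_space)
    next
      fix A assume "A \<in> sets (borel_on Y)"
      with * have "(\<lambda>x. ennreal (measure (Q x) A)) \<in> borel_measurable (borel_on X)"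
        by simp
      then show "(\<lambda>x. emeasure (Q x) A) \<in> borel_measurable (borel_on X)"
        by (rule measurable_cong[THEN iffD1, rotated])
           (use * in \<open>auto simp: space_restrict_space finite_measure.emeasure_eq_measure
              prob_space.finite_measure\<close>)
    qed
  qed
qed

definition joint ::
    "'a::topological_space set \<Rightarrow> 'b::topological_space set \<Rightarrow> 'a measure \<Rightarrow> ('a \<Rightarrow> 'b measure)
      \<Rightarrow> ('a \<times> 'b) measure" where
  "joint X Y P Q = P \<bind> (\<lambda>x. distr (Q x) (borel_on (X \<times> Y)) (Pair x))"

lemma emeasure_joint:
  fixes X :: "'a::second_countable_topology set" and Y :: "'b::second_countable_topology set"
  assumes P: "prob_space P" "sets P = sets (borel_on X)" and Q: "Q \<in> channels X Y"
    and A: "A \<in> sets (borel_on (X \<times> Y))"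
  shows "emeasure (joint X Y P Q) A = (\<integral>\<^sup>+x. (\<integral>\<^sup>+y. indicator A (x, y) \<partial>Q x) \<partial>P)"
proof -
  have sub: "Q \<in> borel_on X \<rightarrow>\<^sub>M subprob_algebra (borel_on Y)"
    using Q unfolding channels_def by (rule measurable_prob_algebraD)
  have space_P: "space P = X"
    using sets_eq_imp_space_eq[OF P(2)] by (simp add: space_restrict_space)
  have id: "(\<lambda>z. z) \<in> borel_on X \<Otimes>\<^sub>M borel_on Y \<rightarrow>\<^sub>M borel_on (X \<times> Y)"
  proof (rule measurable_restrict_space2)
    show "(\<lambda>z. z) \<in> borel_on X \<Otimes>\<^sub>M borel_on Y \<rightarrow>\<^sub>M (borel :: ('a \<times> 'b) measure)"
      unfolding borel_prod[symmetric]
      by (rule measurable_pair)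
         (auto simp: comp_def intro!: measurable_compose[OF measurable_fst]
            measurable_compose[OF measurable_snd] measurable_restrict_space1)
  qed (auto simp: space_pair_measure space_restrict_space)
  have "(\<lambda>x. distr (Q x) (borel_on (X \<times> Y)) (Pair x))
      \<in> borel_on X \<rightarrow>\<^sub>M subprob_algebra (borel_on (X \<times> Y))"
    by (rule measurable_distr2[OF _ sub]) (use id in simp)
  then have K: "(\<lambda>x. distr (Q x) (borel_on (X \<times> Y)) (Pair x))
      \<in> P \<rightarrow>\<^sub>M subprob_algebra (borel_on (X \<times> Y))"
    by (simp cong: measurable_cong_sets add: P(2))
  have "space P \<noteq> {}"
    using P(1) by (rule prob_space.not_empty)
  then have "emeasure (joint X Y P Q) A
      = (\<integral>\<^sup>+x. emeasure (distr (Q x) (borel_on (X \<times> Y)) (Pair x)) A \<partial>P)"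
    unfolding joint_def by (rule emeasure_bind[OF _ K A])
  also have "\<dots> = (\<integral>\<^sup>+x. (\<integral>\<^sup>+y. indicator A (x, y) \<partial>Q x) \<partial>P)"
  proof (rule nn_integral_cong)
    fix x assume x: "x \<in> space P"
    then have "sets (Q x) = sets (borel_on Y)"
      using Q space_P by (simp add: channels_iff)
    moreover have "Pair x \<in> borel_on Y \<rightarrow>\<^sub>M borel_on (X \<times> Y)"
      using x space_P by (intro measurable_compose[OF measurable_Pair1' id])
        (auto simp: space_restrict_space)
    ultimately have pair: "Pair x \<in> Q x \<rightarrow>\<^sub>M borel_on (X \<times> Y)"
      by (simp cong: measurable_cong_sets)
    have "emeasure (distr (Q x) (borel_on (X \<times> Y)) (Pair x)) A
        = (\<integral>\<^sup>+z. indicator A z \<partial>distr (Q x) (borel_on (X \<times> Y)) (Pair x))"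
      using A by simp
    also have "\<dots> = (\<integral>\<^sup>+y. indicator A (x, y) \<partial>Q x)"
      using A by (intro nn_integral_distr[OF pair]) auto
    finally show "emeasure (distr (Q x) (borel_on (X \<times> Y)) (Pair x)) A
        = (\<integral>\<^sup>+y. indicator A (x, y) \<partial>Q x)" .
  qed
  finally show ?thesis .
qed

definition policies :: "'b::topological_space set \<Rightarrow> 'c::topological_space set \<Rightarrow> ('b \<Rightarrow> 'c) set" where
  "policies Y U = borel_on Y \<rightarrow>\<^sub>M borel_on U"

(* The integral and the infimum are real-valued: meaningful for bounded measurable c
   and nonempty U. *)
definition optimal_cost ::
    "'a::topological_space set \<Rightarrow> 'b::topological_space set \<Rightarrow> 'c::topological_space set
      \<Rightarrow> ('a \<times> 'c \<Rightarrow> real) \<Rightarrow> 'a measure \<Rightarrow> ('a \<Rightarrow> 'b measure) \<Rightarrow> real" where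
  "optimal_cost X Y U c P Q =
     (INF \<gamma>\<in>policies Y U. \<integral>(x, y). c (x, \<gamma> y) \<partial>joint X Y P Q)"

definition converges_weakly_at_input ::
    "'a::topological_space set \<Rightarrow> 'b::topological_space set \<Rightarrow> 'a measure
      \<Rightarrow> (nat \<Rightarrow> 'a \<Rightarrow> 'b measure) \<Rightarrow> ('a \<Rightarrow> 'b measure) \<Rightarrow> bool" where
  "converges_weakly_at_input X Y P Qs Q \<longleftrightarrow>
     (\<forall>f :: 'a \<times> 'b \<Rightarrow> real. continuous_on (X \<times> Y) f \<and> bounded (f ` (X \<times> Y)) \<longrightarrow>
        (\<lambda>n. \<integral>z. f z \<partial>joint X Y P (Qs n)) \<longlonglongrightarrow> (\<integral>z. f z \<partial>joint X Y P Q))"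

end

theory Submission
  imports Defs
begin

text \<open>
  Fix a policy \<open>\<gamma>\<close>. If \<open>\<gamma>\<close> is continuous, then so is the integrand \<open>(x, y) \<mapsto> c (x, \<gamma> y)\<close>, and
  weak convergence of the joint measures gives convergence of the cost of \<open>\<gamma>\<close> under the channels
  \<open>Q\<^sub>n\<close> to its cost under \<open>Q\<close>. Each optimal cost under \<open>Q\<^sub>n\<close> is at most the cost of \<open>\<gamma>\<close>, so
  the limit superior of the optimal costs is at most the cost of \<open>\<gamma>\<close> under \<open>Q\<close>. An infimum of
  such bounds is a bound, which is why the semicontinuity is an upper one.

  It remains to see that continuous policies are as good as measurable ones for the limit channel
  (\<open>continuous_policy_approx\<close>). By Lusin's theorem (\<open>lusin_compact\<close>), \<open>\<gamma>\<close> is continuous on a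
  compact set \<open>K \<subseteq> Y\<close> whose complement has small probability under the distribution of the
  observation. Dugundji's theorem extends the restriction of \<open>\<gamma>\<close> to \<open>K\<close> continuously to all of
  \<open>Y\<close>, and because \<open>U\<close> is convex the extension still takes its values in \<open>U\<close>. The two policies
  differ only off \<open>K\<close>, so their costs differ by at most the oscillation of the bounded \<open>c\<close> times
  that small probability.
\<close>

section \<open>Lusin's theorem\<close>

lemma inner_regular_measure:
  fixes M :: "'a::polish_space measure"
  assumes M: "finite_measure M" "sets M = sets borel" and S: "S \<in> sets borel" and e: "0 < e"
  obtains K where "compact K" "K \<subseteq> S" "measure M (S - K) < e"
proof -
  interpret finite_measure M by (rule M)
  show thesis
  proof (cases "measure M S < e")
    case True
    then show thesis by (intro that[of "{}"]) auto
  next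
    case False
    have "ennreal (measure M S - e) < emeasure M S"
      using e False by (simp add: emeasure_eq_measure ennreal_less_iff)
    also have "\<dots> = (SUP K \<in> {K. K \<subseteq> S \<and> compact K}. emeasure M K)"
      using M S by (intro inner_regular) (auto simp: emeasure_eq_measure)
    finally obtain K where K: "K \<subseteq> S" "compact K" "ennreal (measure M S - e) < emeasure M K"
      by (auto simp: less_SUP_iff)
    have "measure M S - e < measure M K"
      using K False by (simp add: emeasure_eq_measure ennreal_less_iff)
    moreover have "measure M (S - K) = measure M S - measure M K"
      using K M S by (intro finite_measure_Diff) (auto simp: borel_compact)
    ultimately show thesis
      using K by (intro that[of K]) auto
  qed
qed

text \<open>
  A map is continuous on \<open>K\<close> as soon as the preimages of the sets \<open>b i\<close> of a countable basis are
  relatively open in \<open>K\<close>. Inner regularity provides, for each \<open>i\<close>, disjoint compact sets \<open>C i\<close>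
  inside the preimage of \<open>b i\<close> and \<open>D i\<close> inside the rest of \<open>A\<close> that together nearly exhaust
  \<open>A\<close>. On the intersection \<open>K\<close> of all the \<open>C i \<union> D i\<close> the preimage of \<open>b i\<close> is the complement
  of the closed set \<open>D i\<close>.
\<close>
lemma lusin_compact:
  fixes M :: "'a::polish_space measure" and g :: "'a \<Rightarrow> 'b::second_countable_topology"
  assumes M: "finite_measure M" "sets M = sets borel" and A: "A \<in> sets borel"
    and g: "g \<in> borel_measurable (restrict_space borel A)" and e: "0 < e"
  obtains K where "compact K" "K \<subseteq> A" "continuous_on K g" "measure M (A - K) < e"
proof -
  interpret finite_measure M by (rule M)
  obtain \<B> :: "'b set set" where \<B>: "countable \<B>" "topological_basis \<B>"
    using ex_countable_basis by auto
  have "\<B> \<noteq> {}"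
    using \<B>(2) open_UNIV unfolding topological_basis_def by fastforce
  define b where "b = from_nat_into \<B>"
  have range_b: "range b = \<B>"
    using \<B> \<open>\<B> \<noteq> {}\<close> by (simp add: b_def)
  have open_b: "open (b i)" for i
    using range_b topological_basis_open[OF \<B>(2)] by auto
  define S where "S i = g -` b i \<inter> A" for i
  have S: "S i \<in> sets borel" for i
  proof -
    have "S i \<in> sets (restrict_space borel A)"
      using measurable_sets[OF g borel_open[OF open_b]]
      by (simp add: S_def space_restrict_space)
    then show ?thesis
      using A by (simp add: sets_restrict_space_iff)
  qed
  \<comment> \<open>The tolerances \<open>d i\<close>, used twice for each \<open>i\<close>, sum up to less than \<open>e\<close>.\<close>
  define d where "d i = e / 4 * (1 / 2) ^ Suc i" for i
  have d: "0 < d i" for i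
    using e by (simp add: d_def)
  have "\<exists>C. compact C \<and> C \<subseteq> S i \<and> measure M (S i - C) < d i" for i
    by (rule inner_regular_measure[OF M S d]) blast
  then obtain C where C: "compact (C i)" "C i \<subseteq> S i" "measure M (S i - C i) < d i" for i
    by metis
  have "\<exists>D. compact D \<and> D \<subseteq> A - S i \<and> measure M (A - S i - D) < d i" for i
    by (rule inner_regular_measure[OF M sets.Diff[OF A S] d]) blast
  then obtain D where D: "compact (D i)" "D i \<subseteq> A - S i" "measure M (A - S i - D i) < d i" for i
    by metis
  define K where "K = (\<Inter>i. C i \<union> D i)"
  have K_sub: "K \<subseteq> A"
    using C(2)[of 0] D(2)[of 0] by (auto simp: K_def S_def)
  have compact_K: "compact K"
  proof -
    have "closed K"
      unfolding K_def using C(1) D(1) by (intro closed_INT ballI closed_Un compact_imp_closed)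
    then have "compact ((C 0 \<union> D 0) \<inter> K)"
      using C(1) D(1) by (intro compact_Int_closed compact_Un)
    moreover have "(C 0 \<union> D 0) \<inter> K = K"
      by (auto simp: K_def)
    ultimately show ?thesis
      by simp
  qed
  have preimage: "g x \<in> b i \<longleftrightarrow> x \<notin> D i" if "x \<in> K" for x i
  proof -
    have "x \<in> C i \<or> x \<in> D i"
      using that by (auto simp: K_def)
    then show ?thesis
      using C(2)[of i] D(2)[of i] by (auto simp: S_def)
  qed
  have cont: "continuous_on K g"
    unfolding continuous_on_open_invariant
  proof (intro allI impI)
    fix V :: "'b set" assume "open V"
    then obtain \<V> where \<V>: "\<V> \<subseteq> \<B>" "\<Union>\<V> = V"
      using \<B>(2) unfolding topological_basis_def by blast
    define I where "I = {i. b i \<in> \<V>}"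
    have V: "V = (\<Union>i\<in>I. b i)"
      using \<V> range_b unfolding I_def by blast
    show "\<exists>W. open W \<and> W \<inter> K = g -` V \<inter> K"
    proof (intro exI conjI)
      show "open (\<Union>i\<in>I. - D i)"
        using D(1) by (intro open_UN ballI open_Compl compact_imp_closed)
      show "(\<Union>i\<in>I. - D i) \<inter> K = g -` V \<inter> K"
        using preimage unfolding V by auto
    qed
  qed
  define R where "R i = (S i - C i) \<union> (A - S i - D i)" for i
  have CD_sets: "C i \<in> sets borel" "D i \<in> sets borel" for i
    using C(1) D(1) by (auto simp: borel_compact)
  have R_sets: "R i \<in> sets M" for i
    using CD_sets[of i] S[of i] A unfolding R_def M(2) by auto
  have R_le: "measure M (R i) \<le> 2 * d i" for i
  proof -
    have "measure M (R i) \<le> measure M (S i - C i) + measure M (A - S i - D i)"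
      unfolding R_def using CD_sets[of i] S[of i] A by (intro measure_Un_le) (auto simp: M(2))
    then show ?thesis
      using C(3)[of i] D(3)[of i] by simp
  qed
  have sums: "(\<lambda>i. 2 * d i) sums (e / 2)"
    using sums_mult[OF power_half_series, of "e / 2"] by (simp add: d_def)
  have summable: "summable (\<lambda>i. measure M (R i))"
    by (rule summable_comparison_test'[OF sums_summable[OF sums], of 0]) (use R_le in simp)
  have "measure M (A - K) \<le> measure M (\<Union>i. R i)"
    using R_sets by (intro finite_measure_mono) (auto simp: K_def R_def)
  also have "\<dots> \<le> (\<Sum>i. measure M (R i))"
    using R_sets summable by (intro finite_measure_subadditive_countably) auto
  also have "\<dots> \<le> (\<Sum>i. 2 * d i)"
    using R_le summable sums_summable[OF sums] by (rule suminf_le)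
  also have "\<dots> < e"
    using sums_unique[OF sums] e by simp
  finally show thesis
    using that compact_K K_sub cont by blast
qed

section \<open>Continuous policies are nearly as good as measurable ones\<close>

lemma measurable_policy_cost:
  fixes X :: "'a::second_countable_topology set" and Y :: "'b::second_countable_topology set"
    and U :: "'c::second_countable_topology set" and c :: "'a \<times> 'c \<Rightarrow> real"
  assumes c: "c \<in> borel_measurable (borel_on (X \<times> U))" and \<gamma>: "\<gamma> \<in> policies Y U"
  shows "(\<lambda>(x, y). c (x, \<gamma> y)) \<in> borel_measurable (borel_on (X \<times> Y))"
proof -
  have fst: "fst \<in> borel_on (X \<times> Y) \<rightarrow>\<^sub>M (borel :: 'a measure)"
    by (rule borel_measurable_continuous_on_restrict) (intro continuous_intros)
  have "snd \<in> borel_on (X \<times> Y) \<rightarrow>\<^sub>M borel_on Y"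
    by (rule measurable_restrict_space2)
      (auto simp: space_restrict_space
        intro!: borel_measurable_continuous_on_restrict continuous_intros)
  then have \<gamma>': "(\<lambda>z. \<gamma> (snd z)) \<in> borel_on (X \<times> Y) \<rightarrow>\<^sub>M borel_on U"
    using \<gamma> unfolding policies_def by (rule measurable_compose)
  then have "(\<lambda>z. \<gamma> (snd z)) \<in> borel_on (X \<times> Y) \<rightarrow>\<^sub>M borel"
    by (simp add: measurable_restrict_space2_iff)
  with fst have "(\<lambda>z. (fst z, \<gamma> (snd z))) \<in> borel_on (X \<times> Y) \<rightarrow>\<^sub>M borel"
    by (rule borel_measurable_Pair)
  then have "(\<lambda>z. (fst z, \<gamma> (snd z))) \<in> borel_on (X \<times> Y) \<rightarrow>\<^sub>M borel_on (X \<times> U)"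
    using measurable_space[OF \<gamma>']
    by (intro measurable_restrict_space2) (auto simp: space_restrict_space)
  from measurable_compose[OF this c] show ?thesis
    by (simp add: case_prod_beta)
qed

lemma policies_in_actions: "\<gamma> \<in> policies Y U \<Longrightarrow> y \<in> Y \<Longrightarrow> \<gamma> y \<in> U"
  unfolding policies_def by (drule measurable_space) (auto simp: space_restrict_space)

lemma continuous_policyI: "continuous_on Y \<gamma> \<Longrightarrow> \<gamma> ` Y \<subseteq> U \<Longrightarrow> \<gamma> \<in> policies Y U"
  unfolding policies_def
  by (rule measurable_restrict_space2)
    (auto simp: space_restrict_space intro!: borel_measurable_continuous_on_restrict)

text \<open>
  Lusin's theorem is applied to the distribution \<open>\<nu>\<close> of the observation, that is the second
  marginal of \<open>\<mu>\<close>, moved to the whole space because inner regularity needs a complete metric,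
  which \<open>Y\<close> itself may lack.
\<close>
lemma continuous_policy_approx:
  fixes X :: "'a::second_countable_topology set" and Y :: "'b::polish_space set"
    and U :: "'c::{real_inner, second_countable_topology} set" and c :: "'a \<times> 'c \<Rightarrow> real"
  assumes Y: "Y \<in> sets borel" and U: "convex U" "U \<noteq> {}"
    and \<mu>: "finite_measure \<mu>" "sets \<mu> = sets (borel_on (X \<times> Y))"
    and c: "c \<in> borel_measurable (borel_on (X \<times> U))"
    and bound: "\<And>z. z \<in> X \<times> U \<Longrightarrow> \<bar>c z\<bar> \<le> B"
    and \<gamma>: "\<gamma> \<in> policies Y U" and e: "0 < e"
  obtains \<gamma>' where "\<gamma>' \<in> policies Y U" "continuous_on Y \<gamma>'"
    "(\<integral>(x, y). c (x, \<gamma>' y) \<partial>\<mu>) \<le> (\<integral>(x, y). c (x, \<gamma> y) \<partial>\<mu>) + e"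
proof -
  interpret finite_measure \<mu> by (rule \<mu>)
  have space_\<mu>: "space \<mu> = X \<times> Y"
    using sets_eq_imp_space_eq[OF \<mu>(2)] by (simp add: space_restrict_space)
  have snd: "snd \<in> \<mu> \<rightarrow>\<^sub>M borel"
    using borel_measurable_continuous_on_restrict[of "X \<times> Y" "snd :: 'a \<times> 'b \<Rightarrow> 'b"]
    by (simp add: measurable_cong_sets[OF \<mu>(2) refl] continuous_on_snd)
  define \<nu> where "\<nu> = distr \<mu> borel snd"
  have \<nu>: "finite_measure \<nu>" "sets \<nu> = sets borel"
    using finite_measure_distr[OF snd] by (simp_all add: \<nu>_def)
  have \<gamma>_borel: "\<gamma> \<in> borel_measurable (borel_on Y)"
    using \<gamma> by (simp add: policies_def measurable_restrict_space2_iff)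
  \<comment> \<open>\<open>D\<close> bounds the oscillation of \<open>c\<close>; the summand 1 makes it a divisor even if \<open>B = 0\<close>.\<close>
  define D where "D = 2 * \<bar>B\<bar> + 1"
  have "0 < D" and D: "2 * B \<le> D"
    by (auto simp: D_def)
  obtain K where K: "compact K" "K \<subseteq> Y" "continuous_on K \<gamma>" "measure \<nu> (Y - K) < e / D"
    using lusin_compact[OF \<nu> Y \<gamma>_borel, of "e / D"] e \<open>0 < D\<close> by auto
  have "closedin (top_of_set Y) K"
    using K by (simp add: closed_subset compact_imp_closed)
  moreover have "\<gamma> ` K \<subseteq> U"
    using policies_in_actions[OF \<gamma>] K(2) by auto
  ultimately obtain \<gamma>' where \<gamma>': "continuous_on Y \<gamma>'" "\<gamma>' ` Y \<subseteq> U" "\<And>y. y \<in> K \<Longrightarrow> \<gamma>' y = \<gamma> y"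
    using Dugundji[OF U, of Y K \<gamma>] K(3) by metis
  have \<gamma>'_policy: "\<gamma>' \<in> policies Y U"
    by (rule continuous_policyI[OF \<gamma>'(1,2)])
  define N where "N = snd -` (Y - K) \<inter> space \<mu>"
  have YK: "Y - K \<in> sets borel"
    using Y K(1) by (auto simp: borel_compact)
  have N: "N \<in> sets \<mu>"
    unfolding N_def by (rule measurable_sets[OF snd YK])
  have measure_N: "measure \<mu> N < e / D"
    using K(4) by (simp add: \<nu>_def N_def measure_distr[OF snd YK])
  have integrable: "integrable \<mu> (\<lambda>(x, y). c (x, \<delta> y))" if "\<delta> \<in> policies Y U" for \<delta>
  proof (rule integrable_const_bound[where B = B])
    show "(\<lambda>(x, y). c (x, \<delta> y)) \<in> borel_measurable \<mu>"
      using measurable_policy_cost[OF c that] by (simp add: measurable_cong_sets[OF \<mu>(2) refl])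
    show "AE z in \<mu>. norm (case z of (x, y) \<Rightarrow> c (x, \<delta> y)) \<le> B"
      using bound policies_in_actions[OF that] by (intro AE_I2) (auto simp: space_\<mu>)
  qed
  have integrable_N: "integrable \<mu> (indicator N :: _ \<Rightarrow> real)"
    using N by (intro integrable_real_indicator) (auto simp: emeasure_eq_measure)
  have "(\<integral>(x, y). c (x, \<gamma>' y) \<partial>\<mu>) \<le> (\<integral>z. (case z of (x, y) \<Rightarrow> c (x, \<gamma> y)) + D * indicator N z \<partial>\<mu>)"
  proof (rule integral_mono)
    show "integrable \<mu> (\<lambda>z. (case z of (x, y) \<Rightarrow> c (x, \<gamma> y)) + D * indicator N z)"
      by (intro Bochner_Integration.integrable_add integrable_mult_right integrable_N integrable[OF \<gamma>])
    fix z assume "z \<in> space \<mu>"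
    then obtain x y where z: "z = (x, y)" "x \<in> X" "y \<in> Y"
      by (auto simp: space_\<mu>)
    have "\<bar>c (x, \<gamma>' y)\<bar> \<le> B" "\<bar>c (x, \<gamma> y)\<bar> \<le> B"
      using z bound policies_in_actions[OF \<gamma>] policies_in_actions[OF \<gamma>'_policy] by auto
    then show "(case z of (x, y) \<Rightarrow> c (x, \<gamma>' y)) \<le> (case z of (x, y) \<Rightarrow> c (x, \<gamma> y)) + D * indicator N z"
      using D z \<gamma>'(3)[of y] by (cases "y \<in> K") (auto simp: N_def space_\<mu>)
  qed (rule integrable[OF \<gamma>'_policy])
  also have "\<dots> = (\<integral>(x, y). c (x, \<gamma> y) \<partial>\<mu>) + D * measure \<mu> N"
    using integrable[OF \<gamma>] integrable_N N sets.sets_into_space[OF N]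
    by (subst Bochner_Integration.integral_add) (auto simp: Int_absorb2)
  also have "\<dots> \<le> (\<integral>(x, y). c (x, \<gamma> y) \<partial>\<mu>) + e"
    using measure_N \<open>0 < D\<close> by (simp add: field_simps)
  finally show thesis
    using that \<gamma>'_policy \<gamma>'(1) by blast
qed

section \<open>The joint measure and the optimal cost\<close>

lemma sets_joint:
  assumes P: "prob_space P" "sets P = sets (borel_on X)"
  shows "sets (joint X Y P Q) = sets (borel_on (X \<times> Y))"
  unfolding joint_def by (rule sets_bind) (use prob_space.not_empty[OF P(1)] in simp_all)

lemma space_joint:
  assumes "prob_space P" "sets P = sets (borel_on X)"
  shows "space (joint X Y P Q) = X \<times> Y"
  using sets_eq_imp_space_eq[OF sets_joint[OF assms]] by (simp add: space_restrict_space)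

lemma prob_space_joint:
  fixes X :: "'a::second_countable_topology set" and Y :: "'b::second_countable_topology set"
  assumes P: "prob_space P" "sets P = sets (borel_on X)" and Q: "Q \<in> channels X Y"
  shows "prob_space (joint X Y P Q)"
proof
  interpret P: prob_space P by (rule P)
  have space_P: "space P = X"
    using sets_eq_imp_space_eq[OF P(2)] by (simp add: space_restrict_space)
  have "X \<times> Y \<in> sets (borel_on (X \<times> Y))"
    using sets.top[of "borel_on (X \<times> Y)"] by (simp add: space_restrict_space)
  then have "emeasure (joint X Y P Q) (X \<times> Y) = (\<integral>\<^sup>+x. (\<integral>\<^sup>+y. indicator (X \<times> Y) (x, y) \<partial>Q x) \<partial>P)"
    by (rule emeasure_joint[OF P Q])
  also have "\<dots> = (\<integral>\<^sup>+x. 1 \<partial>P)"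
  proof (rule nn_integral_cong)
    fix x assume x: "x \<in> space P"
    then interpret Qx: prob_space "Q x"
      using Q by (simp add: channels_iff space_P)
    have "sets (Q x) = sets (borel_on Y)"
      using Q x by (simp add: channels_iff space_P)
    from sets_eq_imp_space_eq[OF this] have "space (Q x) = Y"
      by (simp add: space_restrict_space)
    then have "(\<integral>\<^sup>+y. indicator (X \<times> Y) (x, y) \<partial>Q x) = (\<integral>\<^sup>+y. 1 \<partial>Q x)"
      using x by (intro nn_integral_cong) (simp add: space_P)
    then show "(\<integral>\<^sup>+y. indicator (X \<times> Y) (x, y) \<partial>Q x) = 1"
      by (simp add: Qx.emeasure_space_1)
  qed
  finally show "emeasure (joint X Y P Q) (space (joint X Y P Q)) = 1"
    by (simp add: space_joint[OF P] P.emeasure_space_1)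
qed

text \<open>
  The infimum is taken over the reals, where it is a lower bound only of a set that is bounded
  below; this is what the nonnegativity of \<open>c\<close> provides.
\<close>
lemma optimal_cost_le:
  assumes P: "prob_space P" "sets P = sets (borel_on X)"
    and nonneg: "\<And>z. z \<in> X \<times> U \<Longrightarrow> 0 \<le> c z" and \<gamma>: "\<gamma> \<in> policies Y U"
  shows "optimal_cost X Y U c P Q \<le> (\<integral>(x, y). c (x, \<gamma> y) \<partial>joint X Y P Q)"
  unfolding optimal_cost_def
proof (rule cINF_lower[OF _ \<gamma>])
  show "bdd_below ((\<lambda>\<gamma>. \<integral>(x, y). c (x, \<gamma> y) \<partial>joint X Y P Q) ` policies Y U)"
  proof (rule bdd_belowI2)
    fix \<delta> assume "\<delta> \<in> policies Y U"
    then show "0 \<le> (\<integral>(x, y). c (x, \<delta> y) \<partial>joint X Y P Q)"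
      using nonneg policies_in_actions
      by (intro Bochner_Integration.integral_nonneg) (fastforce simp: space_joint[OF P])
  qed
qed

section \<open>Upper semicontinuity of the optimal cost\<close>

text \<open>For a continuous policy the integrand is an admissible test function.\<close>
lemma limsup_optimal_cost_le_continuous_policy:
  assumes P: "prob_space P" "sets P = sets (borel_on X)"
    and nonneg: "\<And>z. z \<in> X \<times> U \<Longrightarrow> 0 \<le> c z"
    and bounded: "bounded (c ` (X \<times> U))" and cont: "continuous_on (X \<times> U) c"
    and conv: "converges_weakly_at_input X Y P Qs Q"
    and \<gamma>: "\<gamma> \<in> policies Y U" "continuous_on Y \<gamma>"
  shows "limsup (\<lambda>n. ereal (optimal_cost X Y U c P (Qs n)))
    \<le> ereal (\<integral>(x, y). c (x, \<gamma> y) \<partial>joint X Y P Q)"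
proof -
  let ?f = "\<lambda>(x, y). c (x, \<gamma> y)"
  have range: "(x, \<gamma> y) \<in> X \<times> U" if "(x, y) \<in> X \<times> Y" for x y
    using that policies_in_actions[OF \<gamma>(1)] by auto
  have "continuous_on (X \<times> Y) (\<lambda>z. (fst z, \<gamma> (snd z)))"
    by (intro continuous_intros continuous_on_compose2[OF \<gamma>(2)]) auto
  then have "continuous_on (X \<times> Y) (\<lambda>z. c (fst z, \<gamma> (snd z)))"
    by (rule continuous_on_compose2[OF cont]) (use range in auto)
  then have "continuous_on (X \<times> Y) ?f"
    by (simp add: case_prod_beta)
  moreover have "bounded (?f ` (X \<times> Y))"
    using range by (intro bounded_subset[OF bounded]) auto
  ultimately have "(\<lambda>n. \<integral>z. ?f z \<partial>joint X Y P (Qs n)) \<longlonglongrightarrow> (\<integral>z. ?f z \<partial>joint X Y P Q)"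
    using conv unfolding converges_weakly_at_input_def by blast
  then have lim: "limsup (\<lambda>n. ereal (\<integral>z. ?f z \<partial>joint X Y P (Qs n))) = ereal (\<integral>z. ?f z \<partial>joint X Y P Q)"
    by (intro lim_imp_Limsup) auto
  show ?thesis
    unfolding lim[symmetric]
    using optimal_cost_le[where U = U and c = c, OF P nonneg \<gamma>(1)]
    by (intro Limsup_mono always_eventually allI) simp
qed

theorem theorem3p2:
  fixes X :: "(real ^ 'n) set" and Y :: "(real ^ 'm) set" and U :: "(real ^ 'k) set"
    and P :: "(real ^ 'n) measure"
    and c :: "(real ^ 'n) \<times> (real ^ 'k) \<Rightarrow> real"
    and Qs :: "nat \<Rightarrow> real ^ 'n \<Rightarrow> (real ^ 'm) measure"
    and Q :: "real ^ 'n \<Rightarrow> (real ^ 'm) measure"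
  assumes "X \<in> sets borel" and "Y \<in> sets borel" and "U \<in> sets borel" and "U \<noteq> {}"
    and "prob_space P" and "sets P = sets (borel_on X)"
    and "\<And>z. z \<in> X \<times> U \<Longrightarrow> 0 \<le> c z"
    and "bounded (c ` (X \<times> U))"
    and "continuous_on (X \<times> U) c"
    and "convex U"
    and "\<And>n. Qs n \<in> channels X Y" and "Q \<in> channels X Y"
    and "converges_weakly_at_input X Y P Qs Q"
  shows "limsup (\<lambda>n. ereal (optimal_cost X Y U c P (Qs n))) \<le> ereal (optimal_cost X Y U c P Q)"
proof -
  note P = \<open>prob_space P\<close> \<open>sets P = sets (borel_on X)\<close>
  let ?L = "limsup (\<lambda>n. ereal (optimal_cost X Y U c P (Qs n)))"
  let ?cost = "\<lambda>\<gamma>. \<integral>(x, y). c (x, \<gamma> y) \<partial>joint X Y P Q"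
  interpret joint: prob_space "joint X Y P Q"
    by (rule prob_space_joint[OF P \<open>Q \<in> channels X Y\<close>])
  obtain B where B: "\<bar>c z\<bar> \<le> B" if "z \<in> X \<times> U" for z
    using \<open>bounded (c ` (X \<times> U))\<close> by (auto simp: bounded_iff)
  have c: "c \<in> borel_measurable (borel_on (X \<times> U))"
    by (rule borel_measurable_continuous_on_restrict) fact
  have le_cost: "?L \<le> ereal (?cost \<gamma>)" if \<gamma>: "\<gamma> \<in> policies Y U" for \<gamma>
  proof (rule ereal_le_epsilon2)
    fix e :: real assume "0 < e"
    with continuous_policy_approx[OF \<open>Y \<in> sets borel\<close> \<open>convex U\<close> \<open>U \<noteq> {}\<close>
        joint.finite_measure_axioms sets_joint[OF P] c B \<gamma>]
    obtain \<gamma>' where \<gamma>': "\<gamma>' \<in> policies Y U" "continuous_on Y \<gamma>'" "?cost \<gamma>' \<le> ?cost \<gamma> + e"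
      by blast
    have "?L \<le> ereal (?cost \<gamma>')"
      by (rule limsup_optimal_cost_le_continuous_policy[OF P _ _ _ _ \<gamma>'(1,2)]) (fact assms)+
    also have "\<dots> \<le> ereal (?cost \<gamma>) + ereal e"
      using \<gamma>'(3) by simp
    finally show "?L \<le> ereal (?cost \<gamma>) + ereal e" .
  qed
  obtain u where "u \<in> U"
    using \<open>U \<noteq> {}\<close> by blast
  then have const: "(\<lambda>_. u) \<in> policies Y U"
    by (intro continuous_policyI) auto
  \<comment> \<open>The costs are real and the limit superior is extended real. If it is infinite, it can only
    be \<open>-\<infinity>\<close>, and there is nothing to show.\<close>
  show ?thesis
  proof (cases ?L)
    case (real r)
    then have "r \<le> ?cost \<gamma>" if "\<gamma> \<in> policies Y U" for \<gamma>
      using le_cost[OF that] by simp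
    then have "r \<le> optimal_cost X Y U c P Q"
      unfolding optimal_cost_def using const by (intro cINF_greatest) auto
    with real show ?thesis
      by simp
  next
    case PInf
    with le_cost[OF const] show ?thesis
      by simp
  next
    case MInf
    then show ?thesis
      by simp
  qed
qed

end
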